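(* Let $G$ be a finite group. If $G$ has an integral, then $G$ has an integral which is a finite group.
   Context: For a group $H$, $H'$ denotes its derived group (commutator subgroup). An integral of a group $G$ is a (possibly infinite) group $H$ such that $H'$ is isomorphic to $G$. *)

theory Defs
  imports "HOL-Algebra.Algebra"
begin

(* The derived group of H is the subgroup derived H (carrier H), viewed as a
   group in its own right. H and G may live on different types. *)
definition is_integral_of ::
    "('b, 'n) monoid_scheme \<Rightarrow> ('a, 'm) monoid_scheme \<Rightarrow> bool" where
  "is_integral_of H G \<longleftrightarrow>
     group H \<and> H\<lparr>carrier := derived H (carrier H)\<rparr> \<cong> G"

end

theory Submission
  imports Defs
begin

text \<open>
  If \<open>D = H'\<close> is finite, finitely many elements of \<open>H\<close> suffice to produce all its commutators, so
  \<open>H\<close> may be assumed finitely generated. Conjugation moves a generator only within a coset of the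
  finite set \<open>D\<close>, so by the pigeonhole principle every element has a positive power that is central.
  Adjoining such powers one generator at a time, and skipping one whenever a power of it is already
  present, yields a central subgroup \<open>M\<close> with \<open>M \<inter> D = 1\<close> that contains a positive power of every
  generator. Then \<open>H/M\<close> is generated by finitely many elements of finite order and has finite derived
  group, hence is finite, and its derived group \<open>DM/M\<close> is isomorphic to \<open>D\<close>.
\<close>

section \<open>Finiteness from torsion generators and a finite derived group\<close>

context group
begin

text \<open>A conjugate \<open>x h x^-1\<close> equals \<open>[x,h] h\<close>, and both factors lie
  in \<open>N\<close>.\<close>

lemma subgroup_containing_derived_normal:
  assumes "subgroup N G" and "derived G (carrier G) \<subseteq> N"
  shows "N \<lhd> G"
proof (rule normal_invI[OF assms(1)])
  fix x h assume x: "x \<in> carrier G" and h: "h \<in> N"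
  have hG: "h \<in> carrier G"
    using h subgroup.mem_carrier[OF assms(1)] by blast
  have "x \<otimes> h \<otimes> inv x \<otimes> inv h \<in> derived G (carrier G)"
    unfolding derived_def using x hG by (intro generate.incl) blast
  then have "x \<otimes> h \<otimes> inv x \<otimes> inv h \<otimes> h \<in> N"
    using assms h by (meson subgroup.m_closed subsetD)
  then show "x \<otimes> h \<otimes> inv x \<in> N"
    using x hG by (simp add: m_assoc)
qed

lemma finite_generate_singleton:
  assumes "x \<in> carrier G" and "n > 0" and "x [^] (n::nat) = \<one>"
  shows "finite (generate G {x})"
proof -
  have "finite (carrier (subgroup_generated G {x}))"
    using finite_cyclic_subgroup[OF assms(1)] assms(2,3) by auto
  then show ?thesis
    using assms(1) by (simp add: carrier_subgroup_generated Int_absorb1)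
qed

text \<open>The elements of \<open>S\<close> are adjoined one at a time. Each subgroup met on the
  way contains the derived group and so is normal; adjoining \<open>x\<close> therefore at most
  multiplies it by the finite cyclic group of \<open>x\<close>.\<close>

lemma finite_generate_torsion:
  assumes "finite S" and "S \<subseteq> carrier G"
    and "\<And>x. x \<in> S \<Longrightarrow> \<exists>n>0. x [^] (n::nat) = \<one>"
    and "finite (derived G (carrier G))"
  shows "finite (generate G (derived G (carrier G) \<union> S))"
  using assms(1-3)
proof (induction S)
  case empty
  have "generate G (derived G (carrier G)) \<subseteq> derived G (carrier G)"
    by (rule generate_subgroup_incl) (auto intro: derived_is_subgroup)
  then show ?case
    using assms(4) finite_subset by auto
next
  case (insert x S)
  let ?D = "derived G (carrier G)"
  let ?R = "generate G (?D \<union> S)" and ?C = "generate G {x}"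
  have D: "?D \<subseteq> carrier G"
    by (simp add: derived_in_carrier)
  have R: "subgroup ?R G" and C: "subgroup ?C G"
    using D insert.prems by (auto intro: generate_is_subgroup)
  have DXR: "?D \<union> S \<subseteq> ?R" and xC: "x \<in> ?C"
    by (auto intro: generate.incl)
  \<comment> \<open>Normality of \<open>?R\<close> is what makes the set product closed under the
    group operations.\<close>
  have "subgroup (?R <#> ?C) G"
    using DXR by (intro mult_norm_subgroup subgroup_containing_derived_normal R C) auto
  moreover have "?D \<union> insert x S \<subseteq> ?R <#> ?C"
  proof
    fix y assume y: "y \<in> ?D \<union> insert x S"
    then have yG: "y \<in> carrier G"
      using D insert.prems by auto
    show "y \<in> ?R <#> ?C"
    proof (cases "y = x")
      case True
      then have "y = \<one> \<otimes> x" using yG by simp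
      then show ?thesis
        unfolding set_mult_def using xC subgroup.one_closed[OF R] by blast
    next
      case False
      then have "y \<in> ?R" using y DXR by auto
      moreover have "y = y \<otimes> \<one>" using yG by simp
      ultimately show ?thesis
        unfolding set_mult_def using subgroup.one_closed[OF C] by blast
    qed
  qed
  ultimately have sub: "generate G (?D \<union> insert x S) \<subseteq> ?R <#> ?C"
    by (intro generate_subgroup_incl)
  have "finite ?C"
    using insert.prems finite_generate_singleton by blast
  moreover have "finite ?R"
    using insert by auto
  ultimately have "finite (?R <#> ?C)"
    unfolding set_mult_def by auto
  then show ?case
    using sub finite_subset by blast
qed

section \<open>Central powers\<close>

text \<open>Extends commutation with \<open>z\<close> from generators to everything that they
  generate.\<close>

lemma subgroup_centralizer_elem:
  assumes "z \<in> carrier G"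
  shows "subgroup {y \<in> carrier G. z \<otimes> y = y \<otimes> z} G"
proof (rule subgroupI)
  fix a assume a: "a \<in> {y \<in> carrier G. z \<otimes> y = y \<otimes> z}"
  then have aG: "a \<in> carrier G" and eq: "z \<otimes> a = a \<otimes> z"
    by auto
  have "a \<otimes> (z \<otimes> inv a) = z \<otimes> a \<otimes> inv a"
    using aG assms unfolding eq by (simp add: m_assoc)
  also have "\<dots> = z"
    using aG assms by (simp add: m_assoc)
  finally have "z \<otimes> inv a = inv a \<otimes> z"
    using a assms by (metis (no_types, lifting) inv_solve_left' inv_closed m_closed mem_Collect_eq)
  then show "inv a \<in> {y \<in> carrier G. z \<otimes> y = y \<otimes> z}"
    using a by simp
next
  fix a b assume "a \<in> {y \<in> carrier G. z \<otimes> y = y \<otimes> z}" "b \<in> {y \<in> carrier G. z \<otimes> y = y \<otimes> z}"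
  then show "a \<otimes> b \<in> {y \<in> carrier G. z \<otimes> y = y \<otimes> z}"
    using assms by (auto simp: m_assoc) (metis m_assoc)
qed (use assms in auto)

text \<open>The commutators of \<open>g [^] n\<close> with the finitely many generators take values
  in a finite set, so two exponents give the same commutators. The power of \<open>g\<close> by
  their difference then commutes with every generator.\<close>

lemma central_power_exists:
  assumes "finite S" and "S \<subseteq> carrier G" and gen: "generate G S = carrier G"
    and fin: "finite (derived G (carrier G))" and g: "g \<in> carrier G"
  shows "\<exists>n>0. \<forall>y\<in>carrier G. g [^] (n::nat) \<otimes> y = y \<otimes> g [^] n"
proof -
  let ?D = "derived G (carrier G)"
  \<comment> \<open>Restricting the function to \<open>S\<close> puts \<open>c n\<close> in the
    extensional function space from \<open>S\<close> to \<open>?D\<close>, which is finite.\<close>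
  define c where "c n = (\<lambda>y\<in>S. g [^] n \<otimes> y \<otimes> inv (g [^] n) \<otimes> inv y)" for n :: nat
  have "c n \<in> S \<rightarrow>\<^sub>E ?D" for n
  proof -
    have "g [^] n \<otimes> y \<otimes> inv (g [^] n) \<otimes> inv y \<in> ?D" if "y \<in> S" for y
      unfolding derived_def
      by (rule generate.incl) (use that g assms(2) in \<open>intro UN_I[of "g [^] n"] UN_I[of y], auto\<close>)
    then show ?thesis by (simp add: c_def)
  qed
  then have "range c \<subseteq> S \<rightarrow>\<^sub>E ?D"
    by (rule image_subsetI)
  moreover have "finite (S \<rightarrow>\<^sub>E ?D)"
    using assms(1) fin by (simp add: finite_PiE)
  ultimately have "finite (range c)"
    by (rule finite_subset)
  then have "\<not> inj c"
    using finite_imageD infinite_UNIV_nat by blast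
  then obtain a b where "c a = c b" "a \<noteq> b"
    unfolding inj_def by blast
  then obtain m n where mn: "c m = c n" "m < n"
    by (metis linorder_neqE_nat)
  define z where "z = g [^] (n - m)"
  have z: "z \<in> carrier G"
    using g by (simp add: z_def)
  have "z \<otimes> y = y \<otimes> z" if "y \<in> S" for y
  proof -
    have y: "y \<in> carrier G" using that assms(2) by auto
    let ?p = "g [^] m"
    have p: "?p \<in> carrier G" using g by simp
    \<comment> \<open>Equality of the commutators \<open>[p,y]\<close> and \<open>[pz,y]\<close>
      reduces, after cancelling \<open>y^-1\<close> and \<open>p\<close> on both sides, to
      \<open>y = z y z^-1\<close>.\<close>
    have n: "g [^] n = ?p \<otimes> z"
      using g mn(2) by (simp add: z_def nat_pow_mult)
    have "?p \<otimes> y \<otimes> inv ?p \<otimes> inv y = (?p \<otimes> z) \<otimes> y \<otimes> inv (?p \<otimes> z) \<otimes> inv y"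
      using fun_cong[OF mn(1), of y] that by (simp add: c_def n)
    then have "?p \<otimes> y \<otimes> inv ?p = (?p \<otimes> z) \<otimes> y \<otimes> inv (?p \<otimes> z)"
      using p y z by (simp only: r_cancel m_closed inv_closed)
    then have "?p \<otimes> (y \<otimes> inv ?p) = ?p \<otimes> (z \<otimes> y \<otimes> inv z \<otimes> inv ?p)"
      using p y z by (simp add: m_assoc inv_mult_group)
    then have "y \<otimes> inv ?p = z \<otimes> y \<otimes> inv z \<otimes> inv ?p"
      using p y z by (simp only: l_cancel m_closed inv_closed)
    then have "y = z \<otimes> y \<otimes> inv z"
      using p y z by (simp only: r_cancel m_closed inv_closed)
    then have "y \<otimes> z = z \<otimes> y \<otimes> inv z \<otimes> z"
      by (rule arg_cong)
    then show ?thesis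
      using y z by (simp add: m_assoc)
  qed
  then have "S \<subseteq> {y \<in> carrier G. z \<otimes> y = y \<otimes> z}"
    using assms(2) by blast
  then have "generate G S \<subseteq> {y \<in> carrier G. z \<otimes> y = y \<otimes> z}"
    by (rule generate_subgroup_incl[OF _ subgroup_centralizer_elem[OF z]])
  then show ?thesis
    using gen mn(2) unfolding z_def by (intro exI[of _ "n - m"]) auto
qed

section \<open>Central subgroups meeting a finite subgroup trivially\<close>

lemma central_subgroup_normal:
  assumes "subgroup M G" and "\<And>z y. z \<in> M \<Longrightarrow> y \<in> carrier G \<Longrightarrow> z \<otimes> y = y \<otimes> z"
  shows "M \<lhd> G"
proof (rule normal_invI[OF assms(1)])
  fix x h assume x: "x \<in> carrier G" and h: "h \<in> M"
  have "h \<in> carrier G" using h subgroup.mem_carrier[OF assms(1)] by blast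
  moreover have "x \<otimes> h \<otimes> inv x = h \<otimes> x \<otimes> inv x"
    using assms(2)[OF h x] by simp
  ultimately show "x \<otimes> h \<otimes> inv x \<in> M"
    using x h by (simp add: m_assoc)
qed

lemma subgroup_nat_pow_closed:
  assumes "subgroup K G" and "x \<in> K"
  shows "x [^] (n::nat) \<in> K"
  by (induction n) (use assms in \<open>auto simp: subgroup.m_closed subgroup.one_closed\<close>)

lemma pow_card_subgroup:
  assumes "subgroup F G" and "f \<in> F"
  shows "f [^] card F = \<one>"
proof -
  have "f [^]\<^bsub>G\<lparr>carrier := F\<rparr>\<^esub> order (G\<lparr>carrier := F\<rparr>) = \<one>\<^bsub>G\<lparr>carrier := F\<rparr>\<^esub>"
    using group.pow_order_eq_1[OF subgroup_imp_group[OF assms(1)]] assms(2) by simp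
  then show ?thesis
    unfolding order_def nat_pow_consistent[of f _ F] by simp
qed

text \<open>The witness is the product of \<open>M\<close> with the cyclic group of
  \<open>z\<close>. If \<open>m z^j\<close> lies in \<open>F\<close>, its power by
  \<open>card F\<close> is trivial, which puts a power of \<open>z\<close> into \<open>M\<close>; as
  no positive power of \<open>z\<close> lies there, \<open>j = 0\<close>, and the element is in
  \<open>M \<inter> F\<close>.\<close>

lemma extend_central_subgroup:
  assumes M: "subgroup M G" "\<And>w y. w \<in> M \<Longrightarrow> y \<in> carrier G \<Longrightarrow> w \<otimes> y = y \<otimes> w"
    and F: "subgroup F G" "finite F" "M \<inter> F = {\<one>}"
    and z: "z \<in> carrier G" "\<And>y. y \<in> carrier G \<Longrightarrow> z \<otimes> y = y \<otimes> z"
    and free: "\<And>n. n > 0 \<Longrightarrow> z [^] (n::nat) \<notin> M"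
  shows "\<exists>N. subgroup N G \<and> (\<forall>w\<in>N. \<forall>y\<in>carrier G. w \<otimes> y = y \<otimes> w) \<and> N \<inter> F = {\<one>} \<and>
    M \<subseteq> N \<and> z \<in> N"
proof (intro exI conjI)
  let ?C = "generate G {z}"
  let ?N = "M <#> ?C"
  have C: "subgroup ?C G"
    using z by (auto intro: generate_is_subgroup)
  have MG: "M \<subseteq> carrier G"
    using M(1) by (rule subgroup.subset)
  show N: "subgroup ?N G"
    by (intro mult_norm_subgroup central_subgroup_normal M C)
  have NE: "\<exists>m\<in>M. \<exists>j::int. w = m \<otimes> z [^] j" if "w \<in> ?N" for w
    using that unfolding set_mult_def generate_pow[OF z(1)] by auto
  show "M \<subseteq> ?N"
  proof
    fix m assume "m \<in> M"
    moreover then have "m = m \<otimes> \<one>" using MG by auto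
    ultimately show "m \<in> ?N"
      unfolding set_mult_def using subgroup.one_closed[OF C] by blast
  qed
  show "z \<in> ?N"
  proof -
    have "z = \<one> \<otimes> z" using z by simp
    then show ?thesis
      unfolding set_mult_def using subgroup.one_closed[OF M(1)] generate.incl[of z "{z}"] by blast
  qed
  have "?N \<subseteq> {w \<in> carrier G. y \<otimes> w = w \<otimes> y}" if y: "y \<in> carrier G" for y
  proof -
    have S: "subgroup {w \<in> carrier G. y \<otimes> w = w \<otimes> y} G"
      by (rule subgroup_centralizer_elem[OF y])
    have "?C \<subseteq> {w \<in> carrier G. y \<otimes> w = w \<otimes> y}"
      using z y by (intro generate_subgroup_incl[OF _ S]) auto
    moreover have "M \<subseteq> {w \<in> carrier G. y \<otimes> w = w \<otimes> y}"
      using M(2) MG y by fastforce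
    ultimately show ?thesis
      unfolding set_mult_def using subgroup.m_closed[OF S] by blast
  qed
  then show "\<forall>w\<in>?N. \<forall>y\<in>carrier G. w \<otimes> y = y \<otimes> w"
    by fastforce
  show "?N \<inter> F = {\<one>}"
  proof
    show "{\<one>} \<subseteq> ?N \<inter> F"
      using subgroup.one_closed[OF N] subgroup.one_closed[OF F(1)] by simp
    show "?N \<inter> F \<subseteq> {\<one>}"
    proof
      fix f assume f: "f \<in> ?N \<inter> F"
      then obtain m j where m: "m \<in> M" and fm: "f = m \<otimes> z [^] (j::int)"
        using NE by blast
      let ?h = "card F"
      have h: "?h > 0"
        using F f by (auto simp: card_gt_0_iff)
      have mG: "m \<in> carrier G" using m MG by auto
      have "\<one> = (m \<otimes> z [^] j) [^] ?h"
        using pow_card_subgroup[OF F(1)] f fm by auto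
      also have "\<dots> = m [^] ?h \<otimes> (z [^] j) [^] ?h"
        using mG z m by (intro pow_mult_distrib M(2)) auto
      also have "(z [^] j) [^] ?h = z [^] (j * int ?h)"
        using z by (simp add: int_pow_pow int_pow_int[symmetric])
      finally have eq: "m [^] ?h \<otimes> z [^] (j * int ?h) = \<one>" ..
      have mh: "m [^] ?h \<in> M"
        using M(1) m by (rule subgroup_nat_pow_closed)
      have "z [^] (j * int ?h) = inv (m [^] ?h)"
        using eq mG z by (metis int_pow_closed inv_equality inv_inv nat_pow_closed)
      then have zM: "z [^] (j * int ?h) \<in> M"
        using mh M(1) by (simp add: subgroup.m_inv_closed)
      \<comment> \<open>The sign of \<open>j\<close> is unknown while \<open>free\<close> speaks of
        natural exponents, so both signs are needed to reach the absolute value.\<close>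
      have zM': "z [^] (- (j * int ?h)) \<in> M"
        using zM M(1) z by (simp add: int_pow_neg subgroup.m_inv_closed)
      have "z [^] nat \<bar>j * int ?h\<bar> \<in> M"
        using zM zM' by (simp add: int_pow_int[symmetric] abs_if del: int_pow_int)
      then have "nat \<bar>j * int ?h\<bar> = 0"
        using free by blast
      then have "j = 0"
        using h by simp
      then have "f = m"
        using fm mG by simp
      then show "f \<in> {\<one>}"
        using f m F(3) by auto
    qed
  qed
qed

text \<open>Induction on \<open>S\<close>: a central power of the new element is adjoined only if
  none of its own positive powers lies in the subgroup already built, which is the condition for
  keeping the intersection with \<open>F\<close> trivial.\<close>

lemma central_complement_exists:
  assumes "finite S" and "S \<subseteq> carrier G" and F: "subgroup F G" "finite F"
    and "\<And>x. x \<in> S \<Longrightarrow> \<exists>n>0. \<forall>y\<in>carrier G. x [^] (n::nat) \<otimes> y = y \<otimes> x [^] n"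
  shows "\<exists>M. subgroup M G \<and> (\<forall>w\<in>M. \<forall>y\<in>carrier G. w \<otimes> y = y \<otimes> w) \<and> M \<inter> F = {\<one>} \<and>
    (\<forall>x\<in>S. \<exists>n>0. x [^] (n::nat) \<in> M)"
  using assms(1,2,5)
proof (induction S)
  case empty
  have "{\<one>} \<inter> F = {\<one>}"
    using subgroup.one_closed[OF F(1)] by simp
  then show ?case
    using triv_subgroup by (intro exI[of _ "{\<one>}"]) auto
next
  case (insert x S)
  obtain M where M: "subgroup M G" "\<forall>w\<in>M. \<forall>y\<in>carrier G. w \<otimes> y = y \<otimes> w" "M \<inter> F = {\<one>}"
    "\<forall>x\<in>S. \<exists>n>0. x [^] (n::nat) \<in> M"
    using insert.IH insert.prems by auto
  obtain k :: nat where k: "k > 0" "\<forall>y\<in>carrier G. x [^] k \<otimes> y = y \<otimes> x [^] k"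
    using insert.prems(2)[of x] by auto
  have x: "x \<in> carrier G" using insert.prems by auto
  show ?case
  \<comment> \<open>The test is made on \<open>x [^] k\<close> because this is the element known to
    be central. If it succeeds, \<open>M\<close> already contains
    \<open>x [^] (k * n)\<close>.\<close>
  proof (cases "\<exists>n>0. (x [^] k) [^] (n::nat) \<in> M")
    case True
    then obtain n :: nat where "n > 0" "x [^] (k * n) \<in> M"
      using x by (auto simp: nat_pow_pow)
    then have "\<exists>n>0. x [^] (n::nat) \<in> M"
      using k(1) by (intro exI[of _ "k * n"]) simp
    then have "\<forall>y\<in>insert x S. \<exists>n>0. y [^] (n::nat) \<in> M"
      using M(4) by blast
    then show ?thesis using M(1-3) by blast
  next
    case False
    then obtain N where N: "subgroup N G" "\<forall>w\<in>N. \<forall>y\<in>carrier G. w \<otimes> y = y \<otimes> w"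
      "N \<inter> F = {\<one>}" "M \<subseteq> N" "x [^] k \<in> N"
      using extend_central_subgroup[OF M(1) _ F M(3), of "x [^] k"] M(2) k(2) nat_pow_closed[OF x]
      by blast
    have "\<forall>y\<in>insert x S. \<exists>n>0. y [^] (n::nat) \<in> N"
      using N(4,5) M(4) k(1) by blast
    then show ?thesis
      using N(1-3) by blast
  qed
qed

section \<open>The finite quotient\<close>

text \<open>Dividing by a central subgroup that contains a positive power of each generator makes
  the generators torsion. The trivial intersection with the derived group ensures that the
  projection is injective on it.\<close>

lemma finite_quotient_preserving_derived:
  assumes S: "finite S" "S \<subseteq> carrier G" "generate G S = carrier G"
    and fin: "finite (derived G (carrier G))"
  shows "\<exists>M. M \<lhd> G \<and> M \<inter> derived G (carrier G) = {\<one>} \<and> finite (carrier (G Mod M))"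
proof -
  let ?D = "derived G (carrier G)"
  have D: "subgroup ?D G"
    by (simp add: derived_is_subgroup)
  obtain M where M: "subgroup M G" "\<forall>w\<in>M. \<forall>y\<in>carrier G. w \<otimes> y = y \<otimes> w" "M \<inter> ?D = {\<one>}"
    "\<forall>x\<in>S. \<exists>n>0. x [^] (n::nat) \<in> M"
    using central_complement_exists[OF S(1,2) D fin] central_power_exists[OF S fin] S(2) by blast
  interpret M: normal M G
    using M by (intro central_subgroup_normal) auto
  let ?Q = "G Mod M" and ?p = "\<lambda>a. M #> a"
  interpret Q: group ?Q
    by (rule M.factorgroup_is_group)
  interpret p: group_hom G ?Q ?p
    using M.r_coset_hom_Mod by unfold_locales
  have surj: "?p ` carrier G = carrier ?Q"
    by (auto simp: FactGroup_def RCOSETS_def)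
  \<comment> \<open>As the image of \<open>?D\<close>, the derived group of the quotient is finite,
    as \<open>finite_generate_torsion\<close> requires.\<close>
  have D': "derived ?Q (carrier ?Q) = ?p ` ?D"
    using p.derived_img[of "carrier G"] surj by simp
  have "\<exists>n>0. y [^]\<^bsub>?Q\<^esub> (n::nat) = \<one>\<^bsub>?Q\<^esub>" if y: "y \<in> ?p ` S" for y
  proof -
    obtain x where x: "x \<in> S" "y = ?p x" using y by blast
    obtain n :: nat where n: "n > 0" "x [^] n \<in> M" using M(4) x by auto
    have "y [^]\<^bsub>?Q\<^esub> n = ?p (x [^] n)"
      using x S(2) p.hom_nat_pow[of x n] by auto
    also have "\<dots> = \<one>\<^bsub>?Q\<^esub>"
      using n(2) M.rcos_const by (simp add: FactGroup_def)
    finally show ?thesis using n(1) by blast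
  qed
  then have "finite (generate ?Q (derived ?Q (carrier ?Q) \<union> ?p ` S))"
    using S fin D' p.hom_closed by (intro Q.finite_generate_torsion) auto
  moreover have "carrier ?Q = generate ?Q (?p ` S)"
    using p.generate_img[OF S(2)] S(3) surj by simp
  moreover have "generate ?Q (?p ` S) \<subseteq> generate ?Q (derived ?Q (carrier ?Q) \<union> ?p ` S)"
    by (intro Q.mono_generate) auto
  ultimately have "finite (carrier ?Q)"
    using finite_subset by metis
  then show ?thesis
    using M.normal_axioms M(3) by blast
qed

section \<open>Reduction to finitely generated groups\<close>

text \<open>There are only finitely many commutators. One pair of elements is chosen for each, and
  the entries of these pairs generate a subgroup that has all the commutators.\<close>

lemma finitely_generated_subgroup_same_derived:
  assumes fin: "finite (derived G (carrier G))"
  shows "\<exists>S. finite S \<and> S \<subseteq> carrier G \<and> derived G (generate G S) = derived G (carrier G)"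
proof -
  let ?D = "derived G (carrier G)"
  let ?c = "\<lambda>(a, b). a \<otimes> b \<otimes> inv a \<otimes> inv b"
  have "derived_set G (carrier G) \<subseteq> ?D"
    unfolding derived_def by (rule subsetI) (rule generate.incl)
  then have "finite (derived_set G (carrier G))"
    using fin by (rule finite_subset)
  \<comment> \<open>Writing the commutators as the image of one map on pairs allows
    \<open>finite_subset_image\<close> to pick a finite set \<open>P\<close> of pairs with the same
    image.\<close>
  moreover have eq: "derived_set G (carrier G) = ?c ` (carrier G \<times> carrier G)"
    by auto
  ultimately have "finite (?c ` (carrier G \<times> carrier G))"
    by (simp only:)
  from finite_subset_image[OF this subset_refl]
  obtain P where P: "P \<subseteq> carrier G \<times> carrier G" "finite P"
      "?c ` (carrier G \<times> carrier G) = ?c ` P"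
    by (elim exE conjE)
  let ?S = "fst ` P \<union> snd ` P"
  have XG: "?S \<subseteq> carrier G"
    using P(1) by auto
  have "derived_set G (carrier G) \<subseteq> derived_set G (generate G ?S)"
  proof
    fix d assume "d \<in> derived_set G (carrier G)"
    then have "d \<in> ?c ` P"
      by (simp only: eq P(3))
    then obtain a b where ab: "(a, b) \<in> P" and d: "d = a \<otimes> b \<otimes> inv a \<otimes> inv b"
      by auto
    have "a \<in> ?S" "b \<in> ?S"
      using ab by force+
    then have "a \<in> generate G ?S" "b \<in> generate G ?S"
      by (auto intro: generate.incl)
    with d show "d \<in> derived_set G (generate G ?S)"
      by blast
  qed
  then have "derived G (carrier G) \<subseteq> derived G (generate G ?S)"
    unfolding derived_def by (rule mono_generate)
  moreover have "derived G (generate G ?S) \<subseteq> derived G (carrier G)"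
    using generate_incl[OF XG] by (rule mono_derived)
  ultimately show ?thesis
    using P(2) XG by (intro exI[of _ ?S]) auto
qed

end

section \<open>Transfer of the derived group and the finite integral\<close>

text \<open>A surjective homomorphism maps the derived group onto the derived group. If
  \<open>h a = h b\<close> there, then \<open>a b^-1\<close> lies both in the kernel and in the
  derived group, hence is trivial.\<close>

lemma (in group_hom) derived_iso:
  assumes "h ` carrier G = carrier H" and "kernel G H h \<inter> derived G (carrier G) = {\<one>}"
  shows "H\<lparr>carrier := derived H (carrier H)\<rparr> \<cong> G\<lparr>carrier := derived G (carrier G)\<rparr>"
proof -
  let ?D = "derived G (carrier G)"
  have D: "subgroup ?D G"
    by (simp add: G.derived_is_subgroup)
  have DG: "?D \<subseteq> carrier G"
    using D by (rule subgroup.subset)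
  interpret GD: group "G\<lparr>carrier := ?D\<rparr>"
    by (rule G.subgroup_imp_group[OF D])
  have img: "derived H (carrier H) = h ` ?D"
    using derived_img[of "carrier G"] assms(1) by simp
  have "inj_on h ?D"
  proof (rule inj_onI)
    fix a b assume ab: "a \<in> ?D" "b \<in> ?D" "h a = h b"
    then have G: "a \<in> carrier G" "b \<in> carrier G"
      using DG by auto
    have "a \<otimes> inv b \<in> ?D"
      using ab D by (simp add: subgroup.m_closed subgroup.m_inv_closed)
    moreover have "a \<otimes> inv b \<in> kernel G H h"
      using ab(3) G by (simp add: kernel_def)
    ultimately have "a \<otimes> inv b = \<one>"
      using assms(2) by auto
    then show "a = b"
      using G by (metis G.inv_equality G.inv_inv G.inv_closed)
  qed
  then have "h \<in> iso (G\<lparr>carrier := ?D\<rparr>) (H\<lparr>carrier := derived H (carrier H)\<rparr>)"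
    using DG by (auto simp: iso_def hom_def bij_betw_def img subsetD)
  then show ?thesis
    using GD.iso_sym is_isoI by blast
qed

text \<open>The quotient group lives on a type of sets over the type of \<open>H\<close>; a copy on
  the natural numbers gives the finite integral a type independent of \<open>H\<close>.\<close>

lemma finite_group_iso_nat_monoid:
  fixes Q :: "('a, 'm) monoid_scheme"
  assumes "group Q" and "finite (carrier Q)"
  obtains K :: "nat monoid" and f where "group K" "finite (carrier K)" "f \<in> iso Q K"
proof -
  obtain f :: "'a \<Rightarrow> nat" where f: "inj_on f (carrier Q)"
    using finite_imp_inj_to_nat_seg[OF assms(2)] by blast
  show thesis
  proof (rule that)
    show "group (image_group f Q)"
      by (rule group.inj_imp_image_group_is_group[OF assms(1) f])
    show "finite (carrier (image_group f Q))"
      using assms(2) by (simp add: image_group_def)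
    show "f \<in> iso Q (image_group f Q)"
      by (rule inj_imp_image_group_iso[OF f])
  qed
qed

theorem theorem2p2:
  fixes G :: "('a, 'm) monoid_scheme"
    and H :: "('b, 'n) monoid_scheme"
  assumes "group G"
    and "finite (carrier G)"
    and "is_integral_of H G"
  shows "\<exists>K :: nat monoid. is_integral_of K G \<and> finite (carrier K)"
proof -
  interpret H: group H
    using assms(3) by (simp add: is_integral_of_def)
  let ?D = "derived H (carrier H)"
  have DG: "H\<lparr>carrier := ?D\<rparr> \<cong> G"
    using assms(3) by (simp add: is_integral_of_def)
  then obtain g where "bij_betw g ?D (carrier G)"
    by (auto simp: is_iso_def iso_def)
  then have fin: "finite ?D"
    using assms(2) by (simp add: bij_betw_finite)
  obtain S where S: "finite S" "S \<subseteq> carrier H" "derived H (generate H S) = ?D"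
    using H.finitely_generated_subgroup_same_derived[OF fin] by blast
  let ?H0 = "H\<lparr>carrier := generate H S\<rparr>"
  have sub: "subgroup (generate H S) H"
    by (rule H.generate_is_subgroup[OF S(2)])
  interpret H0: group ?H0
    by (rule H.subgroup_imp_group[OF sub])
  \<comment> \<open>\<open>?H0\<close> is thus a finitely generated group with the same derived
    group as \<open>H\<close>, and replaces \<open>H\<close> from here on.\<close>
  have D0: "derived ?H0 (carrier ?H0) = ?D"
    using H.derived_consistent[OF subset_refl sub] S(3) by simp
  have XX: "S \<subseteq> generate H S"
    by (auto intro: generate.incl)
  have "generate ?H0 S = carrier ?H0"
    using H.generate_consistent[OF XX sub] by simp
  then obtain M where M: "M \<lhd> ?H0" "M \<inter> ?D = {\<one>\<^bsub>?H0\<^esub>}" "finite (carrier (?H0 Mod M))"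
    using H0.finite_quotient_preserving_derived[OF S(1), unfolded D0] XX fin by auto
  interpret M: normal M ?H0
    by (rule M(1))
  obtain K :: "nat monoid" and f where K: "group K" "finite (carrier K)" "f \<in> iso (?H0 Mod M) K"
    using finite_group_iso_nat_monoid[OF M.factorgroup_is_group M(3)] by blast
  let ?p = "\<lambda>a. M #>\<^bsub>?H0\<^esub> a"
  interpret K: group K by (rule K(1))
  interpret Q: group "?H0 Mod M" by (rule M.factorgroup_is_group)
  interpret p: group_hom ?H0 "?H0 Mod M" ?p
    using M.r_coset_hom_Mod by unfold_locales
  interpret f: group_hom "?H0 Mod M" K f
    by unfold_locales (use K(3) in \<open>simp add: iso_def\<close>)
  \<comment> \<open>The chain runs from the derived group of \<open>K\<close> through those of the
    quotient and of \<open>?H0\<close> to \<open>G\<close>. The kernel is trivial at the first link;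
    at the second it is \<open>M\<close>, which meets \<open>?D\<close> trivially.\<close>
  have "K\<lparr>carrier := derived K (carrier K)\<rparr> \<cong>
      (?H0 Mod M)\<lparr>carrier := derived (?H0 Mod M) (carrier (?H0 Mod M))\<rparr>"
  proof (rule f.derived_iso)
    show "f ` carrier (?H0 Mod M) = carrier K"
      using K(3) by (auto simp: iso_def bij_betw_def)
    have "kernel (?H0 Mod M) K f = {\<one>\<^bsub>?H0 Mod M\<^esub>}"
      using K(3) f.inj_iff_trivial_ker by (simp add: iso_def bij_betw_def)
    then show "kernel (?H0 Mod M) K f \<inter> derived (?H0 Mod M) (carrier (?H0 Mod M)) =
        {\<one>\<^bsub>?H0 Mod M\<^esub>}"
      using subgroup.one_closed[OF Q.derived_is_subgroup[OF subset_refl]] by auto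
  qed
  also have "\<dots> \<cong> ?H0\<lparr>carrier := derived ?H0 (carrier ?H0)\<rparr>"
  proof (rule p.derived_iso)
    show "?p ` carrier ?H0 = carrier (?H0 Mod M)"
      by (auto simp: FactGroup_def RCOSETS_def)
    have "kernel ?H0 (?H0 Mod M) ?p = M"
    proof
      show "kernel ?H0 (?H0 Mod M) ?p \<subseteq> M"
        using H0.coset_join1[OF _ _ M.subgroup_axioms] by (auto simp: kernel_def FactGroup_def)
      show "M \<subseteq> kernel ?H0 (?H0 Mod M) ?p"
        using M.subset M.rcos_const by (auto simp: kernel_def FactGroup_def)
    qed
    then show "kernel ?H0 (?H0 Mod M) ?p \<inter> derived ?H0 (carrier ?H0) = {\<one>\<^bsub>?H0\<^esub>}"
      using M(2) D0 by simp
  qed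
  also have "\<dots> \<cong> G"
    using DG D0 by simp
  finally have "is_integral_of K G"
    using K(1) by (simp add: is_integral_of_def)
  then show ?thesis
    using K(2) by blast
qed

end
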